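(* The vector field $L=\mathbf T+N$ is spacelike with respect to $\mathbf h$, that is, $\mathbf h(L,L)>0$. Furthermore, the $\mathbf g$-null cones $\mathcal C_u$ are $\mathbf h$-spacelike.
   Context: $c_1>c_2>0$; $\mathbf g,\mathbf h$ are symmetric Lorentzian metrics on a slab $[0,T]\times\mathbb R^3$ with inverses $\mathbf g^{-1}=-\partial_t\otimes\partial_t+c_1^2\sum_a\partial_a\otimes\partial_a+\sum_{j,k}\mathrm f(\partial\vec\phi,\partial\vec\psi)\partial_j\otimes\partial_k$ and $\mathbf h^{-1}=-\partial_t\otimes\partial_t+c_2^2\sum_a\partial_a\otimes\partial_a+\sum_{j,k}\mathrm f(\partial\vec\psi)\partial_j\otimes\partial_k$ ($\mathrm f$: smooth functions; $\vec\phi,\vec\psi$ smooth vector fields). Let $g,h$ be the induced (Riemannian) metrics on $\Sigma_t=\{t\}\times\mathbb R^3$. Standing ellipticity assumption: there is $C>0$ such that for all $\xi$, $C^{-1}|\xi|^2\le(g^{-1}-h^{-1})^{ij}\xi_i\xi_j\le C|\xi|^2$ and $-C|\xi|^2\le(g-h)_{ij}\xi^i\xi^j\le-C^{-1}|\xi|^2$. $u$ is an optical function, i.e. a solution of the eikonal equation $(\mathbf g^{-1})^{\alpha\beta}\partial_\alpha u\partial_\beta u=0$ with $\partial_tu>0$ (so $\nabla u\neq0$), and $\mathcal C_u$ denotes its level sets (forward null cones of $\mathbf g$). $\mathbf T=\partial_t$ is the future-directed $\mathbf g$-unit normal of $\Sigma_t$; $b=((g^{-1})^{ij}\partial_iu\partial_ju)^{-1/2}$;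 $N=-b(g^{-1})^{ij}\partial_iu\,\partial_j$; $L=\mathbf T+N$, which is $\mathbf g$-null. A hypersurface is $\mathbf h$-spacelike if its normal is $\mathbf h$-timelike. *)

theory Defs
  imports "HOL-Analysis.Analysis"
begin

text \<open>
  Points of the slab and their tangent vectors and covectors are elements of \<open>real^4\<close>. Spacetime
  indices have type \<open>4\<close>, with index \<open>0\<close> (which equals \<open>4\<close> in this type) for time. Spatial indices
  have type \<open>3\<close> and are embedded by \<open>sp\<close>, since numeral types wrap around (\<open>3 = 0\<close> in type \<open>3\<close>).
  \<open>ddt\<close> and \<open>ddx i\<close> are the coordinate vector fields.
\<close>

definition sp :: "3 \<Rightarrow> 4" where
  "sp i = (if i = 1 then 1 else if i = 2 then 2 else 3)"

definition slab :: "real \<Rightarrow> (real^4) set" where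
  "slab T = {p. 0 \<le> p $ 0 \<and> p $ 0 \<le> T}"

definition ddt :: "real^4" where
  "ddt = axis 0 1"

definition ddx :: "3 \<Rightarrow> real^4" where
  "ddx i = axis (sp i) 1"


subsection \<open>Regularity and derivatives\<close>

text \<open>
  Derivatives are one-sided at the boundary of the slab. On sets that are relatively open in
  \<open>slab T\<close> with \<open>T > 0\<close> the derivative within the set is unique.
\<close>

primrec Ck_on :: "nat \<Rightarrow> 'a set \<Rightarrow> ('a::real_normed_vector \<Rightarrow> 'b::real_normed_vector) \<Rightarrow> bool" where
  "Ck_on 0 S f \<longleftrightarrow> continuous_on S f"
| "Ck_on (Suc k) S f \<longleftrightarrow>
     (\<exists>f'. (\<forall>x\<in>S. (f has_derivative f' x) (at x within S)) \<and> (\<forall>v. Ck_on k S (\<lambda>x. f' x v)))"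

definition smooth_on :: "'a set \<Rightarrow> ('a::real_normed_vector \<Rightarrow> 'b::real_normed_vector) \<Rightarrow> bool" where
  "smooth_on S f \<longleftrightarrow> (\<forall>k. Ck_on k S f)"

definition partial :: "(real^4) set \<Rightarrow> 4 \<Rightarrow> (real^4 \<Rightarrow> 'b::real_normed_vector) \<Rightarrow> real^4 \<Rightarrow> 'b" where
  "partial S \<alpha> f p = frechet_derivative f (at p within S) (axis \<alpha> 1)"

definition differential :: "(real^4) set \<Rightarrow> (real^4 \<Rightarrow> real) \<Rightarrow> real^4 \<Rightarrow> real^4" where
  "differential S w p = (\<chi> \<alpha>. partial S \<alpha> w p)"

definition all_partials :: "(real^4) set \<Rightarrow> (real^4 \<Rightarrow> real^3) \<Rightarrow> real^4 \<Rightarrow> real^3^4" where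
  "all_partials S v p = (\<chi> \<alpha>. partial S \<alpha> v p)"


subsection \<open>Metrics\<close>

definition bil :: "real^'n^'n \<Rightarrow> real^'n \<Rightarrow> real^'n \<Rightarrow> real" where
  "bil A v w = (\<Sum>\<alpha>\<in>UNIV. \<Sum>\<beta>\<in>UNIV. A $ \<alpha> $ \<beta> * v $ \<alpha> * w $ \<beta>)"

definition tensor :: "real^'n \<Rightarrow> real^'n \<Rightarrow> real^'n^'n" where
  "tensor v w = (\<chi> \<alpha> \<beta>. v $ \<alpha> * w $ \<beta>)"

definition minkowski :: "real^4^4" where
  "minkowski = (\<chi> \<alpha> \<beta>. if \<alpha> = \<beta> then (if \<alpha> = 0 then -1 else 1) else 0)"

definition lorentzian :: "real^4^4 \<Rightarrow> bool" where
  "lorentzian A \<longleftrightarrow> transpose A = A \<and>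
     (\<exists>P. invertible P \<and> transpose P ** A ** P = minkowski)"

definition riemannian :: "real^3^3 \<Rightarrow> bool" where
  "riemannian A \<longleftrightarrow> transpose A = A \<and> (\<forall>\<xi>. \<xi> \<noteq> 0 \<longrightarrow> bil A \<xi> \<xi> > 0)"

definition inverse_metric_form :: "real \<Rightarrow> real^3^3 \<Rightarrow> real^4^4" where
  "inverse_metric_form c F =
     - tensor ddt ddt + c\<^sup>2 *\<^sub>R (\<Sum>a\<in>UNIV. tensor (ddx a) (ddx a))
     + (\<Sum>j\<in>UNIV. \<Sum>k\<in>UNIV. (F $ j $ k) *\<^sub>R tensor (ddx j) (ddx k))"

text \<open>The metric induced on the slices of constant time, in the coordinate frame \<open>ddx\<close>.\<close>

definition induced :: "real^4^4 \<Rightarrow> real^3^3" where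
  "induced A = (\<chi> i j. bil A (ddx i) (ddx j))"

definition elliptic :: "real \<Rightarrow> (real^4 \<Rightarrow> real^4^4) \<Rightarrow> (real^4 \<Rightarrow> real^4^4) \<Rightarrow> bool" where
  "elliptic T G H \<longleftrightarrow> (\<exists>C>0. \<forall>p\<in>slab T. \<forall>\<xi>::real^3.
     (let D = matrix_inv (induced (G p)) - matrix_inv (induced (H p))
      in inverse C * (norm \<xi>)\<^sup>2 \<le> bil D \<xi> \<xi> \<and> bil D \<xi> \<xi> \<le> C * (norm \<xi>)\<^sup>2) \<and>
     (let E = induced (G p) - induced (H p)
      in - C * (norm \<xi>)\<^sup>2 \<le> bil E \<xi> \<xi> \<and> bil E \<xi> \<xi> \<le> - inverse C * (norm \<xi>)\<^sup>2))"


subsection \<open>Optical functions and the null frame\<close>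

text \<open>
  The domain \<open>D\<close> of an optical function is relatively open in the slab, possibly the whole slab.
\<close>

definition optical_function ::
    "real \<Rightarrow> (real^4 \<Rightarrow> real^4^4) \<Rightarrow> (real^4) set \<Rightarrow> (real^4 \<Rightarrow> real) \<Rightarrow> bool" where
  "optical_function T G D u \<longleftrightarrow>
     openin (top_of_set (slab T)) D \<and> Ck_on 1 D u \<and>
     (\<forall>p\<in>D. bil (matrix_inv (G p)) (differential D u p) (differential D u p) = 0 \<and>
            partial D 0 u p > 0)"

definition level_set :: "(real^4) set \<Rightarrow> (real^4 \<Rightarrow> real) \<Rightarrow> real \<Rightarrow> (real^4) set" where
  "level_set D u s = {p \<in> D. u p = s}"

definition lapse ::
    "(real^4 \<Rightarrow> real^4^4) \<Rightarrow> (real^4) set \<Rightarrow> (real^4 \<Rightarrow> real) \<Rightarrow> real^4 \<Rightarrow> real" where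
  "lapse G D u p =
     (\<Sum>i\<in>UNIV. \<Sum>j\<in>UNIV. matrix_inv (induced (G p)) $ i $ j *
        partial D (sp i) u p * partial D (sp j) u p) powr (- 1 / 2)"

definition N_field ::
    "(real^4 \<Rightarrow> real^4^4) \<Rightarrow> (real^4) set \<Rightarrow> (real^4 \<Rightarrow> real) \<Rightarrow> real^4 \<Rightarrow> real^4" where
  "N_field G D u p =
     (\<Sum>i\<in>UNIV. \<Sum>j\<in>UNIV.
        (- lapse G D u p * matrix_inv (induced (G p)) $ i $ j * partial D (sp i) u p) *\<^sub>R ddx j)"

definition L_field ::
    "(real^4 \<Rightarrow> real^4^4) \<Rightarrow> (real^4) set \<Rightarrow> (real^4 \<Rightarrow> real) \<Rightarrow> real^4 \<Rightarrow> real^4" where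
  "L_field G D u p = ddt + N_field G D u p"


subsection \<open>Spacelike hypersurfaces\<close>

text \<open>
  \<open>w\<close> is a local defining function, on the neighbourhood \<open>U\<close> of \<open>p\<close> in the slab, of the hypersurface
  \<open>S\<close>. The tangent space of \<open>S\<close> at \<open>p\<close> is then the kernel of the differential of \<open>w\<close>.
\<close>

definition local_defining_function ::
    "real \<Rightarrow> (real^4) set \<Rightarrow> real^4 \<Rightarrow> (real^4) set \<Rightarrow> (real^4 \<Rightarrow> real) \<Rightarrow> bool" where
  "local_defining_function T S p U w \<longleftrightarrow>
     openin (top_of_set (slab T)) U \<and> p \<in> U \<and> Ck_on 1 U w \<and>
     (\<forall>q\<in>U. differential U w q \<noteq> 0) \<and> S \<inter> U = {q \<in> U. w q = 0}"

definition tangent_space :: "(real^4) set \<Rightarrow> (real^4 \<Rightarrow> real) \<Rightarrow> real^4 \<Rightarrow> (real^4) set" where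
  "tangent_space U w p = {X. (\<Sum>\<alpha>\<in>UNIV. X $ \<alpha> * partial U \<alpha> w p) = 0}"

definition normal_to :: "real^4^4 \<Rightarrow> (real^4) set \<Rightarrow> real^4 \<Rightarrow> bool" where
  "normal_to A V \<nu> \<longleftrightarrow> \<nu> \<noteq> 0 \<and> (\<forall>X\<in>V. bil A \<nu> X = 0)"

definition timelike :: "real^4^4 \<Rightarrow> real^4 \<Rightarrow> bool" where
  "timelike A v \<longleftrightarrow> bil A v v < 0"

definition spacelike :: "real^4^4 \<Rightarrow> real^4 \<Rightarrow> bool" where
  "spacelike A v \<longleftrightarrow> bil A v v > 0"

text \<open>The tangent space does not depend on the choice of the defining function.\<close>

definition spacelike_hypersurface ::
    "real \<Rightarrow> (real^4 \<Rightarrow> real^4^4) \<Rightarrow> (real^4) set \<Rightarrow> bool" where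
  "spacelike_hypersurface T H S \<longleftrightarrow>
     (\<forall>p\<in>S. \<exists>U w. local_defining_function T S p U w \<and>
        (\<forall>\<nu>. normal_to (H p) (tangent_space U w p) \<nu> \<longrightarrow> timelike (H p) \<nu>))"

end

theory Submission
  imports Defs
begin

text \<open>
  Everything happens at a single point. Both inverse metrics have the block form
  \<open>-\<partial>\<^sub>t \<otimes> \<partial>\<^sub>t + spatial part\<close>, so \<open>\<partial>\<^sub>t\<close> is a unit normal of the slices for \<open>\<^bold>g\<close> and for \<open>\<^bold>h\<close>
  simultaneously, and the inverse of an induced metric is the spatial block of the inverse
  spacetime metric (\<open>split_form_inverse\<close>). Write \<open>\<xi>\<close> for the spatial part of \<open>du\<close>. The
  eikonal equation then reads \<open>g\<inverse>(\<xi>,\<xi>) = (\<partial>\<^sub>t u)\<^sup>2 > 0\<close>.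

  For the first claim, \<open>N\<close> is minus the \<open>g\<close>-gradient of \<open>u\<close> normalised by the lapse, hence
  \<open>g(N,N) = 1\<close>. Since \<open>h - g\<close> is positive definite,
  \<open>\<^bold>h(L,L) = -1 + h(N,N) > -1 + g(N,N) = 0\<close>.

  For the second claim, \<open>h\<inverse> < g\<inverse>\<close> as quadratic forms, so
  \<open>\<^bold>h\<inverse>(du,du) = -(\<partial>\<^sub>t u)\<^sup>2 + h\<inverse>(\<xi>,\<xi>) < -(\<partial>\<^sub>t u)\<^sup>2 + g\<inverse>(\<xi>,\<xi>) = 0\<close>: the covector \<open>du\<close> is
  \<open>\<^bold>h\<close>-timelike. An \<open>\<^bold>h\<close>-normal of a level set is a multiple of \<open>du\<close> with its index raised
  by \<open>\<^bold>h\<close>, so it is timelike as well (\<open>normal_to_kernel_timelike\<close>).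
\<close>

section \<open>Bilinear forms and their inverses\<close>

lemma bil_eq_inner: "bil A v w = (v v* A) \<bullet> w"
proof -
  have "(v v* A) \<bullet> w = (\<Sum>\<beta>\<in>UNIV. \<Sum>\<alpha>\<in>UNIV. A $ \<alpha> $ \<beta> * v $ \<alpha> * w $ \<beta>)"
    by (simp add: inner_vec_def vector_matrix_mult_def sum_distrib_left mult_ac)
  also have "\<dots> = bil A v w"
    unfolding bil_def by (rule sum.swap)
  finally show ?thesis by (rule sym)
qed

lemma bil_diff: "bil (A - B) v w = bil A v w - bil B v w"
  by (simp add: bil_def algebra_simps sum_subtractf)

lemma bil_scaleR: "bil A (c *\<^sub>R v) (c *\<^sub>R v) = c\<^sup>2 * bil A v v"
  by (simp add: bil_def sum_distrib_left power2_eq_square mult_ac)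

text \<open>
  With \<open>A\<close> a metric and \<open>M\<close> its inverse, \<open>w v* M\<close> is the vector obtained from the covector \<open>w\<close> by
  raising its index, and lowering the index again gives back \<open>w\<close>.
\<close>

lemma bil_raise_index:
  assumes "M ** A = mat 1"
  shows "bil A (w v* M) (w v* M) = bil M w w"
proof -
  have "bil A (w v* M) (w v* M) = w \<bullet> (w v* M)"
    by (simp add: bil_eq_inner vector_matrix_mul_assoc assms)
  then show ?thesis
    by (simp add: bil_eq_inner inner_commute)
qed

lemma matrix_inv_inverse:
  assumes "invertible A"
  shows "A ** matrix_inv A = mat 1" and "matrix_inv A ** A = mat 1"
  using someI_ex[OF assms[unfolded invertible_def]] by (simp_all add: matrix_inv_def)

lemma matrix_inv_eqI:
  fixes A B :: "'a::semiring_1^'n^'n"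
  assumes "A ** B = mat 1" and "B ** A = mat 1"
  shows "matrix_inv A = B"
proof -
  have "invertible A" using assms by (auto simp: invertible_def)
  then show ?thesis
    using matrix_inv_inverse(1)[of A] assms(2)
    by (metis matrix_mul_assoc matrix_mul_lid matrix_mul_rid)
qed

lemma vanishing_on_kernel_imp_parallel:
  fixes \<xi> \<eta> :: "'a::real_inner"
  assumes "\<And>X. \<xi> \<bullet> X = 0 \<Longrightarrow> \<eta> \<bullet> X = 0"
  obtains c where "\<eta> = c *\<^sub>R \<xi>"
proof (cases "\<xi> = 0")
  case True
  with assms[of \<eta>] that show ?thesis by simp
next
  case False
  define c where "c = (\<eta> \<bullet> \<xi>) / (\<xi> \<bullet> \<xi>)"
  define X where "X = \<eta> - c *\<^sub>R \<xi>"
  have "\<xi> \<bullet> X = 0"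
    using False by (simp add: X_def c_def inner_diff_right inner_commute)
  with assms have "X \<bullet> X = 0"
    by (simp add: X_def inner_diff_left)
  then have "\<eta> = c *\<^sub>R \<xi>" by (simp add: X_def)
  with that show ?thesis .
qed

text \<open>
  Lowering the index of a normal \<open>\<nu>\<close> of \<open>ker \<xi>\<close> gives a multiple of \<open>\<xi>\<close>, so \<open>\<nu>\<close> and \<open>\<xi>\<close> have
  the same causal character.
\<close>

lemma normal_to_kernel_timelike:
  assumes inv: "A ** M = mat 1" "M ** A = mat 1"
    and neg: "bil M \<xi> \<xi> < 0"
    and normal: "normal_to A {X. \<xi> \<bullet> X = 0} \<nu>"
  shows "timelike A \<nu>"
proof -
  have "\<nu> \<noteq> 0" and "\<And>X. \<xi> \<bullet> X = 0 \<Longrightarrow> (\<nu> v* A) \<bullet> X = 0"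
    using normal by (auto simp: normal_to_def bil_eq_inner)
  then obtain c where c: "\<nu> v* A = c *\<^sub>R \<xi>"
    using vanishing_on_kernel_imp_parallel by metis
  have "\<nu> = (\<nu> v* A) v* M"
    by (simp add: vector_matrix_mul_assoc inv)
  also have "\<dots> = c *\<^sub>R (\<xi> v* M)"
    by (simp add: c scaleR_vector_matrix_assoc)
  finally have \<nu>: "\<nu> = c *\<^sub>R (\<xi> v* M)" .
  with \<open>\<nu> \<noteq> 0\<close> have "c \<noteq> 0" by auto
  moreover have "bil A \<nu> \<nu> = c\<^sup>2 * bil M \<xi> \<xi>"
    by (simp add: \<nu> bil_scaleR bil_raise_index inv)
  ultimately show ?thesis
    using neg by (simp add: timelike_def mult_pos_neg)
qed

lemma lorentzian_imp_invertible:
  assumes "lorentzian A"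
  shows "invertible A"
proof -
  obtain P where P: "transpose P ** A ** P = minkowski"
    using assms by (auto simp: lorentzian_def)
  have "minkowski $ \<alpha> $ \<gamma> * minkowski $ \<gamma> $ \<beta> = (if \<gamma> = \<alpha> then if \<alpha> = \<beta> then 1 else 0 else 0)"
    for \<alpha> \<beta> \<gamma>
    by (simp add: minkowski_def)
  then have "minkowski ** minkowski = mat 1"
    by (simp add: matrix_matrix_mult_def mat_def vec_eq_iff)
  then have "det minkowski \<noteq> 0"
    using invertible_def invertible_det_nz by blast
  then have "det A \<noteq> 0"
    unfolding P[symmetric] by (simp add: det_mul)
  then show ?thesis by (simp add: invertible_det_nz)
qed


section \<open>Splitting off the time direction\<close>

lemma sp_eq_iff [simp]: "sp i = sp j \<longleftrightarrow> i = j"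
  using exhaust_3[of i] exhaust_3[of j] by (auto simp: sp_def)

lemma sp_neq_0 [simp]: "sp i \<noteq> 0" "0 \<noteq> sp i"
  by (auto simp: sp_def)

lemma UNIV_4_time_space: "(UNIV :: 4 set) = insert 0 (range sp)"
proof -
  have "x \<in> insert 0 (range sp)" for x
  proof -
    have "sp 1 = 1" "sp 2 = 2" "sp 3 = 3" by (auto simp: sp_def)
    then have "1 \<in> range sp" "2 \<in> range sp" "3 \<in> range sp"
      by (metis rangeI)+
    moreover have "(4::4) = 0" by simp
    ultimately show ?thesis
      using exhaust_4[of x] by (elim disjE) simp_all
  qed
  then show ?thesis by blast
qed

lemma sum_time_space: "sum f (UNIV :: 4 set) = f 0 + (\<Sum>i\<in>UNIV. f (sp i))"
proof -
  have "inj sp" by (rule injI) simp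
  then have "sum f (range sp) = (\<Sum>i\<in>UNIV. f (sp i))"
    by (simp add: sum.reindex)
  moreover have "0 \<notin> range sp" by auto
  ultimately show ?thesis
    unfolding UNIV_4_time_space by simp
qed

definition space_part :: "real^4 \<Rightarrow> real^3" where
  "space_part v = (\<chi> i. v $ sp i)"

lemma induced_nth [simp]: "induced A $ i $ j = A $ sp i $ sp j"
proof -
  have "A $ \<alpha> $ \<beta> * axis (sp i) 1 $ \<alpha> * axis (sp j) 1 $ \<beta> =
      (if \<beta> = sp j then if \<alpha> = sp i then A $ \<alpha> $ \<beta> else 0 else 0)" for \<alpha> \<beta>
    by (simp add: axis_def)
  then show ?thesis
    by (simp add: induced_def bil_def ddx_def)
qed

text \<open>
  Unit lapse and zero shift. The condition has the same form for a metric and for its inverse, and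
  serves for both.
\<close>

definition split_form :: "real^4^4 \<Rightarrow> bool" where
  "split_form A \<longleftrightarrow> A $ 0 $ 0 = -1 \<and> (\<forall>i. A $ 0 $ sp i = 0 \<and> A $ sp i $ 0 = 0)"

lemma split_form_inverse_metric_form: "split_form (inverse_metric_form c F)"
  by (simp add: split_form_def inverse_metric_form_def tensor_def ddt_def ddx_def axis_def)

lemma bil_split_form:
  assumes "split_form A"
  shows "bil A v w = - (v $ 0 * w $ 0) + bil (induced A) (space_part v) (space_part w)"
  using assms by (simp add: split_form_def bil_def sum_time_space space_part_def)

text \<open>
  A block diagonal matrix is inverted block by block. This is what lets \<open>\<^bold>g\<inverse>\<close> and \<open>\<^bold>h\<inverse>\<close> be
  compared through the induced metrics, which is where the ellipticity assumption lives.
\<close>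

lemma split_form_inverse:
  assumes inv: "A ** M = mat 1" "M ** A = mat 1" and M: "split_form M"
  shows "split_form A" and "induced A ** induced M = mat 1"
    and "induced M ** induced A = mat 1" and "matrix_inv (induced A) = induced M"
proof -
  have AM: "(\<Sum>\<gamma>\<in>UNIV. A $ \<alpha> $ \<gamma> * M $ \<gamma> $ \<beta>) = (if \<alpha> = \<beta> then 1 else 0)" for \<alpha> \<beta>
    using inv(1) by (simp add: matrix_matrix_mult_def mat_def vec_eq_iff)
  have MA: "(\<Sum>\<gamma>\<in>UNIV. M $ \<alpha> $ \<gamma> * A $ \<gamma> $ \<beta>) = (if \<alpha> = \<beta> then 1 else 0)" for \<alpha> \<beta>
    using inv(2) by (simp add: matrix_matrix_mult_def mat_def vec_eq_iff)
  show "split_form A"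
    using AM[of 0 0] AM[of "sp _" 0] MA[of 0 "sp _"] M
    by (simp add: sum_time_space split_form_def)
  show *: "induced A ** induced M = mat 1"
    using AM[of "sp _" "sp _"] M
    by (simp add: matrix_matrix_mult_def mat_def vec_eq_iff sum_time_space split_form_def)
  then show **: "induced M ** induced A = mat 1"
    by (simp add: matrix_left_right_inverse)
  show "matrix_inv (induced A) = induced M"
    using * ** by (rule matrix_inv_eqI)
qed


section \<open>The null vector field\<close>

lemma L_field_time: "L_field G D u p $ 0 = 1"
  by (simp add: L_field_def N_field_def ddt_def ddx_def axis_def)

lemma space_part_L_field:
  "space_part (L_field G D u p) =
     (- lapse G D u p) *\<^sub>R (space_part (differential D u p) v* matrix_inv (induced (G p)))"
proof -
  have "space_part (L_field G D u p) $ k =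
      (\<Sum>i\<in>UNIV. \<Sum>j\<in>UNIV. if k = j then
         - lapse G D u p * matrix_inv (induced (G p)) $ i $ j * partial D (sp i) u p else 0)" for k
    by (simp add: space_part_def L_field_def N_field_def ddt_def ddx_def axis_def
        if_distrib cong: if_cong)
  then show ?thesis
    by (simp add: vec_eq_iff vector_matrix_mult_def space_part_def differential_def
        sum_distrib_left sum_negf mult_ac)
qed

lemma lapse_eq:
  "lapse G D u p =
     bil (matrix_inv (induced (G p))) (space_part (differential D u p))
       (space_part (differential D u p)) powr (- 1 / 2)"
  by (simp add: lapse_def bil_def space_part_def differential_def)

lemma induced_metric_N:
  assumes inv: "matrix_inv (induced (G p)) ** induced (G p) = mat 1"
    and pos: "bil (matrix_inv (induced (G p))) (space_part (differential D u p))
                (space_part (differential D u p)) > 0"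
  shows "bil (induced (G p)) (space_part (L_field G D u p)) (space_part (L_field G D u p)) = 1"
proof -
  let ?q = "bil (matrix_inv (induced (G p))) (space_part (differential D u p))
              (space_part (differential D u p))"
  have "(lapse G D u p)\<^sup>2 = ?q powr - 1"
    by (simp add: lapse_eq power2_eq_square powr_add[symmetric])
  with pos have "(lapse G D u p)\<^sup>2 * ?q = 1"
    by (simp add: powr_minus)
  then show ?thesis
    unfolding space_part_L_field bil_scaleR bil_raise_index[OF inv] by simp
qed


section \<open>Level sets\<close>

text \<open>
  The two functions have exactly the same derivatives, so the choice made by
  \<open>frechet_derivative\<close> agrees even where the derivative is not unique.
\<close>

lemma partial_diff_const:
  fixes f :: "real^4 \<Rightarrow> real"
  shows "partial S \<alpha> (\<lambda>x. f x - s) p = partial S \<alpha> f p"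
proof -
  have "((\<lambda>x. f x - s) has_derivative f') (at p within S) \<longleftrightarrow> (f has_derivative f') (at p within S)"
    for f'
    using has_derivative_add_const[of "\<lambda>x. f x - s" f' "at p within S" s]
      has_derivative_add_const[of f f' "at p within S" "- s"] by auto
  then show ?thesis
    by (simp add: partial_def frechet_derivative_def)
qed

lemma Ck_on_1_diff_const:
  fixes f :: "'a::real_normed_vector \<Rightarrow> 'b::real_normed_vector"
  assumes "Ck_on 1 S f"
  shows "Ck_on 1 S (\<lambda>x. f x - s)"
  using assms has_derivative_add_const[of f _ _ "- s"] by auto

lemma local_defining_function_level_set:
  assumes "openin (top_of_set (slab T)) D" and "Ck_on 1 D u" and "p \<in> D"
    and "\<And>q. q \<in> D \<Longrightarrow> differential D u q \<noteq> 0"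
  shows "local_defining_function T (level_set D u s) p D (\<lambda>x. u x - s)"
proof -
  have "differential D (\<lambda>x. u x - s) q = differential D u q" for q
    by (simp add: differential_def partial_diff_const)
  with assms show ?thesis
    by (auto simp: local_defining_function_def level_set_def
        simp del: One_nat_def intro: Ck_on_1_diff_const)
qed

lemma tangent_space_level_set:
  "tangent_space D (\<lambda>x. u x - s) p = {X. differential D u p \<bullet> X = 0}"
  by (simp add: tangent_space_def partial_diff_const differential_def inner_vec_def mult.commute)


section \<open>Comparison of the two metrics on null vectors and null cones\<close>

theorem lemma9p1:
  fixes c1 c2 T :: real
    and G H :: "real^4 \<Rightarrow> real^4^4"
    and \<phi> \<psi> :: "real^4 \<Rightarrow> real^3"
    and fG :: "(real^3^4) \<times> (real^3^4) \<Rightarrow> real^3^3"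
    and fH :: "real^3^4 \<Rightarrow> real^3^3"
    and D :: "(real^4) set"
    and u :: "real^4 \<Rightarrow> real"
  assumes "c1 > c2" and "c2 > 0" and "T > 0"
    and "smooth_on (slab T) \<phi>" and "smooth_on (slab T) \<psi>"
    and "smooth_on UNIV fG" and "smooth_on UNIV fH"
    and "\<And>p. p \<in> slab T \<Longrightarrow> lorentzian (G p)"
    and "\<And>p. p \<in> slab T \<Longrightarrow> lorentzian (H p)"
    and "\<And>p. p \<in> slab T \<Longrightarrow>
           matrix_inv (G p) =
             inverse_metric_form c1 (fG (all_partials (slab T) \<phi> p, all_partials (slab T) \<psi> p))"
    and "\<And>p. p \<in> slab T \<Longrightarrow>
           matrix_inv (H p) = inverse_metric_form c2 (fH (all_partials (slab T) \<psi> p))"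
    and "\<And>p. p \<in> slab T \<Longrightarrow> riemannian (induced (G p))"
    and "\<And>p. p \<in> slab T \<Longrightarrow> riemannian (induced (H p))"
    and "elliptic T G H"
    and "optical_function T G D u"
  shows "(\<forall>p\<in>D. spacelike (H p) (L_field G D u p)) \<and>
         (\<forall>s. spacelike_hypersurface T H (level_set D u s))"
proof (intro conjI ballI allI)
  from \<open>elliptic T G H\<close> obtain C where "C > 0"
    and C_inv: "\<And>p \<xi>. p \<in> slab T \<Longrightarrow> inverse C * (norm \<xi>)\<^sup>2
          \<le> bil (matrix_inv (induced (G p)) - matrix_inv (induced (H p))) \<xi> \<xi>"
    and C_met: "\<And>p \<xi>. p \<in> slab T \<Longrightarrow>
          bil (induced (G p) - induced (H p)) \<xi> \<xi> \<le> - inverse C * (norm \<xi>)\<^sup>2"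
    unfolding elliptic_def Let_def by metis
  have D_open: "openin (top_of_set (slab T)) D" and u_C1: "Ck_on 1 D u"
    and eikonal: "\<And>p. p \<in> D \<Longrightarrow>
          bil (matrix_inv (G p)) (differential D u p) (differential D u p) = 0"
    and du_pos: "\<And>p. p \<in> D \<Longrightarrow> differential D u p $ 0 > 0"
    using \<open>optical_function T G D u\<close> by (auto simp: optical_function_def differential_def)
  have D_slab: "p \<in> slab T" if "p \<in> D" for p
    using D_open that openin_imp_subset by blast

  have G_inv: "G p ** matrix_inv (G p) = mat 1" "matrix_inv (G p) ** G p = mat 1"
    and H_inv: "H p ** matrix_inv (H p) = mat 1" "matrix_inv (H p) ** H p = mat 1"
    and G_split: "split_form (matrix_inv (G p))" and H_split: "split_form (matrix_inv (H p))"
    if "p \<in> D" for p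
    using assms(8-11)[OF D_slab[OF that]] matrix_inv_inverse[OF lorentzian_imp_invertible]
      split_form_inverse_metric_form by metis+
  note G_block = split_form_inverse[OF G_inv G_split]
  note H_block = split_form_inverse[OF H_inv H_split]

  have spatial_eikonal: "bil (matrix_inv (induced (G p))) (space_part (differential D u p))
      (space_part (differential D u p)) = (differential D u p $ 0)\<^sup>2" if "p \<in> D" for p
    using eikonal[OF that] that
    by (simp add: bil_split_form[OF G_split] G_block(4) power2_eq_square)

  show "spacelike (H p) (L_field G D u p)" if p: "p \<in> D" for p
  proof -
    let ?n = "space_part (L_field G D u p)"
    (* g(N,N) = 1, since the spatial part of L is N *)
    have g1: "bil (induced (G p)) ?n ?n = 1"
      using p G_block(3,4)[of p] spatial_eikonal[OF p] du_pos[OF p]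
      by (intro induced_metric_N) simp_all
    then have "?n \<noteq> 0" by (auto simp: bil_def)
    then have "0 < inverse C * (norm ?n)\<^sup>2"
      using \<open>C > 0\<close> by simp
    with C_met[OF D_slab[OF p], of ?n] g1 have "bil (induced (H p)) ?n ?n > 1"
      by (simp add: bil_diff)
    then show ?thesis
      using p by (simp add: spacelike_def bil_split_form[OF H_block(1)] L_field_time)
  qed

  show "spacelike_hypersurface T H (level_set D u s)" for s
    unfolding spacelike_hypersurface_def
  proof (intro ballI exI conjI allI impI)
    fix p assume "p \<in> level_set D u s"
    then have p: "p \<in> D" by (simp add: level_set_def)
    let ?\<xi> = "space_part (differential D u p)"
    show "local_defining_function T (level_set D u s) p D (\<lambda>x. u x - s)"
      using du_pos by (intro local_defining_function_level_set D_open u_C1 p) force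
    fix \<nu> assume \<nu>: "normal_to (H p) (tangent_space D (\<lambda>x. u x - s) p) \<nu>"
    have "?\<xi> \<noteq> 0"
      using spatial_eikonal[OF p] du_pos[OF p] by (auto simp: bil_def)
    then have "0 < inverse C * (norm ?\<xi>)\<^sup>2"
      using \<open>C > 0\<close> by simp
    with C_inv[OF D_slab[OF p], of ?\<xi>]
    have "bil (matrix_inv (induced (H p))) ?\<xi> ?\<xi> < (differential D u p $ 0)\<^sup>2"
      by (simp add: bil_diff spatial_eikonal[OF p])
    then have "bil (matrix_inv (H p)) (differential D u p) (differential D u p) < 0"
      using p by (simp add: bil_split_form[OF H_split] H_block(4) power2_eq_square)
    with \<nu> show "timelike (H p) \<nu>"
      using normal_to_kernel_timelike[OF H_inv[OF p]] by (simp add: tangent_space_level_set)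
  qed
qed

end
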